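(* Let $\alpha=(j_1,j_2,\dots)\in(\mathbb{N}\setminus\{1\})^{\mathbb{N}}$ be a sequence of integers greater than or equal to $2$, and let $f_\alpha:\Delta_\alpha\to\Delta_\alpha$ be the $\alpha$-adic adding machine. Then the dynamical system $(\Delta_\alpha,f_\alpha)$ is strachite.
   Context: $\mathbb{N}$ is the set of positive integers and $\mathbb{N}_0=\mathbb{N}\cup\{0\}$. Adding machine. For $\alpha=(j_1,j_2,\dots)$ with all $j_n\ge 2$ integers, $\Delta_\alpha$ is the set of all sequences $(x_1,x_2,\dots)$ with $x_n\in\{0,1,\dots,j_n-1\}$ for every $n\in\mathbb{N}$. It carries the metric $d_\alpha$ given by $d_\alpha(x,y)=2^{-n}$ if $x\ne y$, where $n$ is the first natural number with $x_n\neq y_n$, and $d_\alpha(x,x)=0$. Addition with carry on $\Delta_\alpha$ is defined by $(x_n)_n+(y_n)_n=(z_n)_n$, where $t_0=0$ and, for $n\ge1$, $z_n\in\{0,\dots,j_n-1\}$ is $x_n+y_n+t_{n-1}$ mod $j_n$ and $t_n=\lfloor (x_n+y_n+t_{n-1})/j_n\rfloor$. The map is $f_\alpha(x)=x+(1,0,0,\dots)$. Open dynamical systems. Let $(\mathcal{M},d)$ be a compact metric space, $f:\mathcal{M}\to\mathcal{M}$ continuous, $N\in\mathbb{N}$, $p_1,\dots,p_N\in\mathcal{M}$ pairwise distinct points (the centers), and for each $i=1,\dots,N$ let $\{\rho^i_n\}_{n=1}^\infty$ be a decreasing sequence of positive real numbers with $\lim_{n\to\infty}\rho^i_n=0$.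 Let $B^i_n=B_{\rho^i_n}(p_i)$ be the open ball with center $p_i$ and radius $\rho^i_n$. With the convention $\min\emptyset=+\infty$, a point $x\in\mathcal{M}$ belongs to $\mathfrak{T}(i)$ if for infinitely many $n\in\mathbb{N}$ the inequality $$\min\{k\in\mathbb{N}_0:f^k(x)\in B^i_n\}<\min\{k\in\mathbb{N}_0:f^k(x)\in B^j_n\}$$ holds for all $j\in\{1,\dots,N\}$ with $j\neq i$. Put $\mathfrak{T}=\bigcap_{j=1}^N\mathfrak{T}(j)$. A subset of a topological space is residual if its complement is a countable union of nowhere dense sets. The open dynamical system given by $(\mathcal{M},d,f)$, the $p_i$ and the $\rho^i_n$ is completely indecisive if $\mathfrak{T}$ is residual in $\mathcal{M}$. Strachite. $(\mathcal{M},f)$ is strachite if for every $N\in\mathbb{N}$ there exists a residual set $\mathcal{R}\subseteq\mathcal{M}^N$ such that, for every $(p_1,\dots,p_N)\in\mathcal{R}$ with pairwise distinct entries and every collection of decreasing sequences of positive reals $\{\rho^i_n\}_{n=1}^\infty$, $i=1,\dots,N$, each converging to $0$, the corresponding open dynamical system is completely indecisive. *)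

theory Defs
  imports "HOL-Analysis.Analysis" "HOL-Library.Extended_Nat"
begin

section \<open>Residual sets\<close>

definition nowhere_dense_in :: "'a topology \<Rightarrow> 'a set \<Rightarrow> bool" where
  "nowhere_dense_in X S \<longleftrightarrow> S \<subseteq> topspace X \<and> X interior_of (X closure_of S) = {}"

definition residual_in :: "'a topology \<Rightarrow> 'a set \<Rightarrow> bool" where
  "residual_in X R \<longleftrightarrow> R \<subseteq> topspace X \<and>
     (\<exists>\<C>. countable \<C> \<and> (\<forall>S\<in>\<C>. nowhere_dense_in X S) \<and> topspace X - R = \<Union>\<C>)"

section \<open>Open dynamical systems\<close>

locale dynamical_system = Metric_space M d for M :: "'a set" and d +
  fixes f :: "'a \<Rightarrow> 'a"
  assumes compact: "compact_space mtopology"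
    and continuous: "continuous_map mtopology mtopology f"
begin

text \<open>The infimum of the empty set in \<^typ>\<open>enat\<close> is \<open>\<infinity>\<close>, in accordance with the
  convention that a point never entering \<open>B\<close> has hitting time \<open>+\<infinity>\<close>.\<close>

definition hitting_time :: "'a set \<Rightarrow> 'a \<Rightarrow> enat" where
  "hitting_time B x = Inf {enat k |k. (f ^^ k) x \<in> B}"

text \<open>The centers are \<open>p 1, \<dots>, p N\<close>. The radius sequences \<open>\<rho> i\<close> are indexed from \<open>0\<close>,
  that is, \<open>\<rho> i n\<close> stands for the radius with index \<open>n + 1\<close>.\<close>

definition first_hit_set ::
    "nat \<Rightarrow> (nat \<Rightarrow> 'a) \<Rightarrow> (nat \<Rightarrow> nat \<Rightarrow> real) \<Rightarrow> nat \<Rightarrow> 'a set" where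
  "first_hit_set N p \<rho> i =
     {x \<in> M. infinite {n. \<forall>j\<in>{1..N}. j \<noteq> i \<longrightarrow>
        hitting_time (mball (p i) (\<rho> i n)) x < hitting_time (mball (p j) (\<rho> j n)) x}}"

definition completely_indecisive ::
    "nat \<Rightarrow> (nat \<Rightarrow> 'a) \<Rightarrow> (nat \<Rightarrow> nat \<Rightarrow> real) \<Rightarrow> bool" where
  "completely_indecisive N p \<rho> \<longleftrightarrow>
     residual_in mtopology (\<Inter>i\<in>{1..N}. first_hit_set N p \<rho> i)"

text \<open>Decreasing is understood in the non-strict sense (\<^const>\<open>decseq\<close>).\<close>

definition strachite :: bool where
  "strachite \<longleftrightarrow>
     (\<forall>N\<ge>1. \<exists>R. residual_in (product_topology (\<lambda>_. mtopology) {1..N}) R \<and>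
        (\<forall>p\<in>R. inj_on p {1..N} \<longrightarrow>
           (\<forall>\<rho>. (\<forall>i\<in>{1..N}. decseq (\<rho> i) \<and> (\<forall>n. 0 < \<rho> i n) \<and> \<rho> i \<longlonglongrightarrow> 0) \<longrightarrow>
              completely_indecisive N p \<rho>)))"

end

section \<open>Adding machines\<close>

text \<open>Sequences are indexed from \<open>0\<close>: \<open>\<alpha> n\<close> and \<open>x n\<close> stand for the entries with index
  \<open>n + 1\<close> of the usual one-based notation. This is why the exponent in the metric is the successor
  of the first index of disagreement.\<close>

definition adding_space :: "(nat \<Rightarrow> nat) \<Rightarrow> (nat \<Rightarrow> nat) set" where
  "adding_space \<alpha> = {x. \<forall>n. x n \<in> {0..\<alpha> n - 1}}"

text \<open>The formula for the metric does not involve \<open>\<alpha>\<close>.\<close>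

definition adding_dist :: "(nat \<Rightarrow> nat) \<Rightarrow> (nat \<Rightarrow> nat) \<Rightarrow> real" where
  "adding_dist x y = (if x = y then 0 else 1 / 2 ^ Suc (LEAST n. x n \<noteq> y n))"

text \<open>\<open>carry \<alpha> x y n\<close> is the carry into position \<open>n\<close> (zero-based), i.e. the carry produced by
  the first \<open>n\<close> positions.\<close>

primrec carry :: "(nat \<Rightarrow> nat) \<Rightarrow> (nat \<Rightarrow> nat) \<Rightarrow> (nat \<Rightarrow> nat) \<Rightarrow> nat \<Rightarrow> nat" where
  "carry \<alpha> x y 0 = 0"
| "carry \<alpha> x y (Suc n) = (x n + y n + carry \<alpha> x y n) div \<alpha> n"

definition adding_plus :: "(nat \<Rightarrow> nat) \<Rightarrow> (nat \<Rightarrow> nat) \<Rightarrow> (nat \<Rightarrow> nat) \<Rightarrow> nat \<Rightarrow> nat" where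
  "adding_plus \<alpha> x y = (\<lambda>n. (x n + y n + carry \<alpha> x y n) mod \<alpha> n)"

definition adding_machine :: "(nat \<Rightarrow> nat) \<Rightarrow> (nat \<Rightarrow> nat) \<Rightarrow> nat \<Rightarrow> nat" where
  "adding_machine \<alpha> x = adding_plus \<alpha> x (\<lambda>n. if n = 0 then 1 else 0)"

lemma adding_dist_less_iff: "adding_dist x y < 1 / 2 ^ k \<longleftrightarrow> (\<forall>n<k. x n = y n)"
proof (cases "x = y")
  case True
  then show ?thesis by (simp add: adding_dist_def)
next
  case False
  define m where "m = (LEAST n. x n \<noteq> y n)"
  from False have "\<exists>n. x n \<noteq> y n" by auto
  then have neq: "x m \<noteq> y m" unfolding m_def by (rule LeastI_ex)
  have eq: "x n = y n" if "n < m" for n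
    using not_less_Least[of n "\<lambda>n. x n \<noteq> y n"] that by (auto simp: m_def)
  have "adding_dist x y < 1 / 2 ^ k \<longleftrightarrow> (2::real) ^ k < 2 ^ Suc m"
    using False by (simp add: adding_dist_def m_def field_simps del: power_Suc)
  also have "\<dots> \<longleftrightarrow> k \<le> m"
    by (subst power_strict_increasing_iff) auto
  also have "\<dots> \<longleftrightarrow> (\<forall>n<k. x n = y n)"
    using neq eq by (meson le_less_trans not_le order_less_le_trans)
  finally show ?thesis .
qed

lemma Metric_space_adding: "Metric_space (adding_space \<alpha>) adding_dist"
proof
  show "0 \<le> adding_dist x y" for x y
    by (simp add: adding_dist_def)
  show "adding_dist x y = adding_dist y x" for x y
    by (simp add: adding_dist_def eq_commute)
  show "adding_dist x y = 0 \<longleftrightarrow> x = y" for x y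
    by (simp add: adding_dist_def)
  show "adding_dist x z \<le> adding_dist x y + adding_dist y z" for x y z
  proof (cases "x = z")
    case True
    then show ?thesis by (simp add: adding_dist_def)
  next
    case False
    define m where "m = (LEAST n. x n \<noteq> z n)"
    from False have "\<exists>n. x n \<noteq> z n" by auto
    then have "x m \<noteq> z m" unfolding m_def by (rule LeastI_ex)
    then have "\<not> (\<forall>n<Suc m. x n = y n) \<or> \<not> (\<forall>n<Suc m. y n = z n)" by force
    then have "1 / 2 ^ Suc m \<le> adding_dist x y \<or> 1 / 2 ^ Suc m \<le> adding_dist y z"
      using adding_dist_less_iff not_le by blast
    moreover have "adding_dist x z = 1 / 2 ^ Suc m"
      using False by (simp add: adding_dist_def m_def)
    moreover have "0 \<le> adding_dist x y" "0 \<le> adding_dist y z"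
      by (simp_all add: adding_dist_def)
    ultimately show ?thesis by linarith
  qed
qed

lemma inverse_two_power_less: "0 < (e::real) \<Longrightarrow> \<exists>k. 1 / 2 ^ k < e"
  using real_arch_pow_inv[of e "1/2"] by (auto simp: power_one_over)

theorem dynamical_system_adding_machine:
  assumes "\<forall>n. 2 \<le> \<alpha> n"
  shows "dynamical_system (adding_space \<alpha>) adding_dist (adding_machine \<alpha>)"
proof -
  interpret Metric_space "adding_space \<alpha>" adding_dist by (rule Metric_space_adding)
  have pos: "0 < \<alpha> n" for n using assms[rule_format, of n] by simp
  show ?thesis
  proof
    let ?X = "product_topology (\<lambda>n. discrete_topology {0..\<alpha> n - 1}) UNIV"
    have top: "topspace ?X = adding_space \<alpha>"
      by (auto simp: adding_space_def PiE_def Pi_def)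
    have "continuous_map ?X mtopology (\<lambda>x. x)"
      unfolding continuous_map_to_metric
    proof (intro ballI allI impI)
      fix x :: "nat \<Rightarrow> nat" and e :: real
      assume x: "x \<in> topspace ?X" and "0 < e"
      then obtain k where k: "1 / 2 ^ k < e" using inverse_two_power_less by blast
      let ?S = "\<lambda>n. if n < k then {x n} else {0..\<alpha> n - 1}"
      have xs: "\<And>n. x n \<le> \<alpha> n - 1" using x top by (auto simp: adding_space_def)
      show "\<exists>U. openin ?X U \<and> x \<in> U \<and> (\<forall>y\<in>U. y \<in> mball x e)"
      proof (intro exI conjI ballI)
        have "finite {n \<in> UNIV. ?S n \<noteq> topspace (discrete_topology {0..\<alpha> n - 1})}"
          by (rule finite_subset[of _ "{..<k}"]) auto
        then show "openin ?X (PiE UNIV ?S)"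
          using xs by (auto simp: openin_PiE_gen)
        show "x \<in> PiE UNIV ?S" using xs by auto
        fix y assume y: "y \<in> PiE UNIV ?S"
        then have yS: "y n \<in> ?S n" for n by blast
        have "y n \<in> {0..\<alpha> n - 1}" for n
          using yS[of n] xs[of n] by (cases "n < k") auto
        moreover have "\<forall>n<k. x n = y n"
          using yS by (metis singletonD)
        ultimately have "y \<in> adding_space \<alpha>" "\<forall>n<k. x n = y n"
          by (auto simp: adding_space_def)
        then show "y \<in> mball x e"
          using x top k adding_dist_less_iff[of x y k] by auto
      qed
    qed
    moreover have "compactin ?X (adding_space \<alpha>)"
      using top compact_space_def compact_space_product_topology
      by (metis compact_space_discrete_topology finite_atLeastAtMost)
    ultimately show "compact_space mtopology"
      using image_compactin[of ?X "adding_space \<alpha>" mtopology "\<lambda>x. x"]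
      by (simp add: compact_space_def)
  next
    let ?u = "\<lambda>n::nat. if n = 0 then 1 else 0 :: nat"
    have carry: "carry \<alpha> x ?u n = carry \<alpha> y ?u n" if "\<forall>i<n. x i = y i" for x y n
      using that by (induction n) auto
    have agree: "\<forall>n<k. adding_machine \<alpha> x n = adding_machine \<alpha> y n"
      if "\<forall>n<k. x n = y n" for x y k
      using that carry[of _ x y] by (auto simp: adding_machine_def adding_plus_def)
    have "adding_machine \<alpha> ` adding_space \<alpha> \<subseteq> adding_space \<alpha>"
    proof clarify
      fix x
      have "adding_machine \<alpha> x n < \<alpha> n" for n
        using pos by (simp add: adding_machine_def adding_plus_def)
      then have "adding_machine \<alpha> x n \<le> \<alpha> n - 1" for n
        by (metis Suc_leI Suc_pred' pos Suc_le_mono)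
      then show "adding_machine \<alpha> x \<in> adding_space \<alpha>"
        by (simp add: adding_space_def)
    qed
    moreover have "\<exists>\<delta>>0. \<forall>y. y \<in> adding_space \<alpha> \<and> adding_dist x y < \<delta> \<longrightarrow>
        adding_dist (adding_machine \<alpha> x) (adding_machine \<alpha> y) < e" if "0 < e" for x e
    proof -
      obtain k where k: "1 / 2 ^ k < e" using inverse_two_power_less \<open>0 < e\<close> by blast
      show ?thesis
        by (rule exI[of _ "1 / 2 ^ k"])
          (use k agree in \<open>auto simp: adding_dist_less_iff intro: less_trans[OF _ k]\<close>)
    qed
    ultimately show "continuous_map mtopology mtopology (adding_machine \<alpha>)"
      unfolding metric_continuous_map[OF Metric_space_adding] by blast
  qed
qed

end

theory Submission
  imports Defs
begin

text \<open>The proof separates a general criterion from the arithmetic of the adding machine. The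
  criterion is: a system without isolated points in which every point has a dense backward orbit
  is strachite.

  For the criterion, the generic condition on the centers is that no center lies on the forward
  orbit of another one. Each equation \<open>f\<^sup>k (p\<^sub>j) = p\<^sub>i\<close> with \<open>i \<noteq> j\<close> defines a closed set of tuples,
  and in a space without isolated points it can be destroyed by moving \<open>p\<^sub>i\<close> alone, so this condition
  is residual. Now let \<open>y\<close> be a point with \<open>f\<^sup>r (y) = p\<^sub>i\<close>. It reaches the center \<open>p\<^sub>i\<close> at time \<open>r\<close>,
  and up to that time it has met no other center, for otherwise this other center would have \<open>p\<^sub>i\<close>
  on its forward orbit. As soon as all balls are small enough, a whole neighbourhood of \<open>y\<close> enters
  the ball around \<open>p\<^sub>i\<close> first; how fast the radii shrink relative to each other does not
  matter (\<open>backward_orbit_eventually_leads\<close>). Since such \<open>y\<close> are dense, the set of points entering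
  the ball around \<open>p\<^sub>i\<close> first for infinitely many \<open>n\<close> contains a countable intersection of dense open
  sets.

  For the adding machine, the first \<open>L\<close> digits of a point encode a residue modulo
  \<open>\<alpha>\<^sub>0 \<cdots> \<alpha>\<^bsub>L-1\<^esub>\<close>, on which the map acts as addition of one. The map is onto, so any point \<open>a\<close> has
  predecessors of every order; choosing the order in the right residue class makes the
  first \<open>L\<close> digits of the predecessor whatever is desired. Hence backward orbits are dense.\<close>

section \<open>Residual sets\<close>

lemma nowhere_dense_in_subset:
  assumes "nowhere_dense_in X S" "T \<subseteq> S"
  shows "nowhere_dense_in X T"
  using assms interior_of_mono[OF closure_of_mono[OF assms(2)], of X X]
  unfolding nowhere_dense_in_def by auto

text \<open>It is enough to cover the complement: intersecting the covering sets with the complement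
  leaves them nowhere dense.\<close>

lemma residual_in_if_complement_covered:
  assumes "R \<subseteq> topspace X" "countable \<C>"
    and closed: "\<And>S. S \<in> \<C> \<Longrightarrow> closedin X S"
    and thin: "\<And>S. S \<in> \<C> \<Longrightarrow> X interior_of S = {}"
    and cover: "topspace X - R \<subseteq> \<Union>\<C>"
  shows "residual_in X R"
  unfolding residual_in_def
proof (intro conjI exI ballI)
  show "countable ((\<lambda>S. S - R) ` \<C>)" using assms(2) by simp
  show "topspace X - R = \<Union>((\<lambda>S. S - R) ` \<C>)"
    using cover closedin_subset[OF closed] by auto
next
  fix T assume "T \<in> (\<lambda>S. S - R) ` \<C>"
  then obtain S where S: "S \<in> \<C>" "T = S - R" by blast
  have "nowhere_dense_in X S"
    using closed[OF S(1)] thin[OF S(1)]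
    by (simp add: nowhere_dense_in_def closedin_subset closure_of_closedin)
  then show "nowhere_dense_in X T"
    by (rule nowhere_dense_in_subset) (use S in auto)
qed (fact assms(1))

section \<open>A criterion for being strachite\<close>

context dynamical_system
begin

lemma continuous_map_funpow: "continuous_map mtopology mtopology (f ^^ k)"
proof (induction k)
  case (Suc k)
  then show ?case
    using continuous_map_compose[OF _ continuous] by (simp add: o_def)
qed (simp add: id_def)

lemma hitting_time_less:
  assumes "(f ^^ r) x \<in> B" "\<And>l. l \<le> r \<Longrightarrow> (f ^^ l) x \<notin> C"
  shows "hitting_time B x < hitting_time C x"
proof -
  have "hitting_time B x \<le> enat r"
    unfolding hitting_time_def by (rule Inf_lower) (use assms(1) in auto)
  also have "enat r < enat (Suc r)" by simp
  also have "enat (Suc r) \<le> hitting_time C x"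
    unfolding hitting_time_def
  proof (rule Inf_greatest)
    fix t assume "t \<in> {enat k |k. (f ^^ k) x \<in> C}"
    then obtain k where "t = enat k" "(f ^^ k) x \<in> C" by auto
    then show "enat (Suc r) \<le> t" using assms(2)[of k] by (cases "k \<le> r") auto
  qed
  finally show ?thesis .
qed

definition leading_set ::
    "nat \<Rightarrow> (nat \<Rightarrow> 'a) \<Rightarrow> (nat \<Rightarrow> nat \<Rightarrow> real) \<Rightarrow> nat \<Rightarrow> nat \<Rightarrow> 'a set" where
  "leading_set N p \<rho> i n = {x \<in> M. \<forall>j\<in>{1..N}. j \<noteq> i \<longrightarrow>
     hitting_time (mball (p i) (\<rho> i n)) x < hitting_time (mball (p j) (\<rho> j n)) x}"

text \<open>A point that arrives at \<open>p i\<close> at time \<open>r\<close> without having met another center keeps, up to time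
  \<open>r\<close>, a positive distance from the other centers. Once the radii are below this distance, the same
  finitely many conditions hold on a neighbourhood. Closed balls serve as the sets to be avoided,
  so that avoiding them is an open condition.\<close>

lemma backward_orbit_eventually_leads:
  assumes y: "y \<in> M" and hit: "(f ^^ r) y = p i" and i: "i \<in> {1..N}"
    and p: "\<And>j. j \<in> {1..N} \<Longrightarrow> p j \<in> M"
    and avoid: "\<And>j l. j \<in> {1..N} \<Longrightarrow> j \<noteq> i \<Longrightarrow> l \<le> r \<Longrightarrow> (f ^^ l) y \<noteq> p j"
    and pos: "\<And>n. 0 < \<rho> i n"
    and lim: "\<And>j. j \<in> {1..N} \<Longrightarrow> \<rho> j \<longlonglongrightarrow> 0"
  shows "\<forall>\<^sub>F n in sequentially. y \<in> mtopology interior_of leading_set N p \<rho> i n"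
proof -
  have fM: "(f ^^ l) z \<in> M" if "z \<in> M" for l z
    using continuous_map_image_subset_topspace[OF continuous_map_funpow] that by auto
  have "\<forall>\<^sub>F n in sequentially. \<forall>j\<in>{1..N} - {i}. \<forall>l\<in>{..r}. \<rho> j n < d (p j) ((f ^^ l) y)"
  proof (intro eventually_ball_finite ballI)
    fix j l assume "j \<in> {1..N} - {i}" "l \<in> {..r}"
    then have "0 < d (p j) ((f ^^ l) y)" "\<rho> j \<longlonglongrightarrow> 0"
      using avoid[of j l] p[of j] fM[OF y] lim by (auto simp: less_le)
    then show "\<forall>\<^sub>F n in sequentially. \<rho> j n < d (p j) ((f ^^ l) y)"
      by (simp add: order_tendstoD(2))
  qed auto
  then show ?thesis
  proof (rule eventually_mono)
    fix n
    assume small: "\<forall>j\<in>{1..N} - {i}. \<forall>l\<in>{..r}. \<rho> j n < d (p j) ((f ^^ l) y)"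
    define V where "V = {z \<in> topspace mtopology. (f ^^ r) z \<in> mball (p i) (\<rho> i n)} \<inter>
      (\<Inter>(j, l) \<in> ({1..N} - {i}) \<times> {..r}.
        {z \<in> topspace mtopology. (f ^^ l) z \<in> topspace mtopology - mcball (p j) (\<rho> j n)})"
    have "openin mtopology V"
      unfolding V_def
    proof (rule openin_Int_Inter)
      show "openin mtopology {z \<in> topspace mtopology. (f ^^ r) z \<in> mball (p i) (\<rho> i n)}"
        by (rule openin_continuous_map_preimage[OF continuous_map_funpow openin_mball])
    next
      fix W assume "W \<in> (\<lambda>(j, l). {z \<in> topspace mtopology.
        (f ^^ l) z \<in> topspace mtopology - mcball (p j) (\<rho> j n)}) ` (({1..N} - {i}) \<times> {..r})"
      then obtain j l where "W = {z \<in> topspace mtopology.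
        (f ^^ l) z \<in> topspace mtopology - mcball (p j) (\<rho> j n)}" by auto
      then show "openin mtopology W"
        by (simp only: openin_continuous_map_preimage[OF continuous_map_funpow
            openin_diff[OF openin_topspace closedin_mcball]])
    qed simp
    moreover have "y \<in> V"
      unfolding V_def using y hit p[OF i] pos[of n] small fM[OF y] by (auto simp: not_le)
    moreover have "V \<subseteq> leading_set N p \<rho> i n"
    proof
      fix z assume z: "z \<in> V"
      have "(f ^^ l) z \<notin> mball (p j) (\<rho> j n)"
        if "j \<in> {1..N}" "j \<noteq> i" "l \<le> r" for j l
        using z that by (simp add: V_def) (metis DiffI atMost_iff atLeastAtMost_iff less_imp_le singletonD)
      then show "z \<in> leading_set N p \<rho> i n"
        using z hitting_time_less[of r z] by (simp add: V_def leading_set_def)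
    qed
    ultimately show "y \<in> mtopology interior_of leading_set N p \<rho> i n"
      by (meson interior_of_maximal subsetD)
  qed
qed

text \<open>Backward orbits of \<open>p i\<close> supply points in every open set at which \<open>i\<close> leads robustly from some
  index on; so for each \<open>m\<close> the points robustly led by \<open>i\<close> at some index \<open>n \<ge> m\<close> form a dense open
  set. Being led infinitely often follows from lying in all of these sets.\<close>

lemma completely_indecisive_if_orbits_avoid_centers:
  assumes dense: "\<And>a x e. a \<in> M \<Longrightarrow> x \<in> M \<Longrightarrow> 0 < e \<Longrightarrow> \<exists>y\<in>mball x e. \<exists>r. (f ^^ r) y = a"
    and N: "1 \<le> N"
    and p: "\<And>i. i \<in> {1..N} \<Longrightarrow> p i \<in> M"
    and orbits: "\<And>i j k. i \<in> {1..N} \<Longrightarrow> j \<in> {1..N} \<Longrightarrow> i \<noteq> j \<Longrightarrow> (f ^^ k) (p j) \<noteq> p i"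
    and pos: "\<And>i n. i \<in> {1..N} \<Longrightarrow> 0 < \<rho> i n"
    and lim: "\<And>i. i \<in> {1..N} \<Longrightarrow> \<rho> i \<longlonglongrightarrow> 0"
  shows "completely_indecisive N p \<rho>"
proof -
  define U where "U i m = (\<Union>n\<in>{m..}. mtopology interior_of leading_set N p \<rho> i n)" for i m
  have U_open: "openin mtopology (U i m)" for i m
    unfolding U_def by (intro openin_Union) auto
  have U_dense: "U i m \<inter> W \<noteq> {}"
    if i: "i \<in> {1..N}" and W: "openin mtopology W" "W \<noteq> {}" for i m W
  proof -
    obtain x e where xe: "x \<in> M" "0 < e" "mball x e \<subseteq> W"
      using W openin_mtopology by (metis ex_in_conv subsetD)
    obtain y r where y: "y \<in> mball x e" and r: "(f ^^ r) y = p i"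
      using dense[OF p[OF i] xe(1,2)] by blast
    have avoid: "(f ^^ l) y \<noteq> p j" if "j \<in> {1..N}" "j \<noteq> i" "l \<le> r" for j l
    proof
      assume "(f ^^ l) y = p j"
      then have "(f ^^ (r - l)) (p j) = (f ^^ (r - l + l)) y" by (simp add: funpow_add)
      also have "\<dots> = p i" using \<open>l \<le> r\<close> r by simp
      finally show False using orbits i that by blast
    qed
    have "\<forall>\<^sub>F n in sequentially. y \<in> mtopology interior_of leading_set N p \<rho> i n"
      by (rule backward_orbit_eventually_leads[where r = r]) (use y r i p avoid pos lim in auto)
    then obtain n where "m \<le> n" "y \<in> mtopology interior_of leading_set N p \<rho> i n"
      unfolding eventually_sequentially by (meson nle_le)
    then have "y \<in> U i m" unfolding U_def by blast
    then show ?thesis using y xe(3) by blast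
  qed
  have sub: "(\<Inter>m. U i m) \<subseteq> first_hit_set N p \<rho> i" for i
  proof
    fix x assume x: "x \<in> (\<Inter>m. U i m)"
    have "\<exists>n\<ge>m. x \<in> leading_set N p \<rho> i n" for m
      using x interior_of_subset[of mtopology] unfolding U_def by blast
    then show "x \<in> first_hit_set N p \<rho> i"
      unfolding first_hit_set_def leading_set_def infinite_nat_iff_unbounded_le by auto
  qed
  show ?thesis
    unfolding completely_indecisive_def
  proof (rule residual_in_if_complement_covered)
    show "(\<Inter>i\<in>{1..N}. first_hit_set N p \<rho> i) \<subseteq> topspace mtopology"
      using N by (auto simp: first_hit_set_def)
    show "countable ((\<lambda>(i, m). topspace mtopology - U i m) ` ({1..N} \<times> UNIV))" by simp
    show "topspace mtopology - (\<Inter>i\<in>{1..N}. first_hit_set N p \<rho> i)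
        \<subseteq> \<Union>((\<lambda>(i, m). topspace mtopology - U i m) ` ({1..N} \<times> UNIV))"
      using sub by fastforce
  next
    fix S assume "S \<in> (\<lambda>(i, m). topspace mtopology - U i m) ` ({1..N} \<times> UNIV)"
    then obtain i m where i: "i \<in> {1..N}" and S: "S = topspace mtopology - U i m" by auto
    show "closedin mtopology S" using U_open S by blast
    have "U i m \<inter> mtopology interior_of S = {}"
      using S interior_of_subset[of mtopology S] by blast
    then show "mtopology interior_of S = {}"
      using U_dense[OF i openin_interior_of] by blast
  qed
qed

text \<open>The complement is the union of the coincidence sets \<open>f\<^sup>k (p\<^sub>j) = p\<^sub>i\<close>. These are closed because
  the space is Hausdorff, and they have empty interior because \<open>p\<^sub>i\<close> can be moved on its own.\<close>

lemma residual_orbits_avoid_centers: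
  assumes perfect: "\<And>x e. x \<in> M \<Longrightarrow> 0 < e \<Longrightarrow> \<exists>y\<in>mball x e. y \<noteq> x"
    and I: "countable I"
  shows "residual_in (product_topology (\<lambda>_. mtopology) I)
    {p \<in> topspace (product_topology (\<lambda>_. mtopology) I).
       \<forall>i\<in>I. \<forall>j\<in>I. i \<noteq> j \<longrightarrow> (\<forall>k. (f ^^ k) (p j) \<noteq> p i)}"
proof (rule residual_in_if_complement_covered)
  let ?P = "product_topology (\<lambda>_. mtopology) I"
  let ?S = "\<lambda>(i, j, k). {p \<in> topspace ?P. (f ^^ k) (p j) = p i}"
  let ?K = "{(i, j, k). i \<in> I \<and> j \<in> I \<and> i \<noteq> j}"
  have "?K \<subseteq> I \<times> I \<times> UNIV" by auto
  then show "countable (?S ` ?K)"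
    by (rule countable_image[OF countable_subset]) (simp add: I)
  show "topspace ?P - {p \<in> topspace ?P. \<forall>i\<in>I. \<forall>j\<in>I. i \<noteq> j \<longrightarrow> (\<forall>k. (f ^^ k) (p j) \<noteq> p i)}
      \<subseteq> \<Union>(?S ` ?K)" by fastforce
  fix S assume "S \<in> ?S ` ?K"
  then obtain i j k where ij: "i \<in> I" "j \<in> I" "i \<noteq> j"
    and S: "S = {p \<in> topspace ?P. (f ^^ k) (p j) = p i}" by auto
  have "continuous_map ?P mtopology (\<lambda>p. (f ^^ k) (p j))"
    using continuous_map_compose[OF continuous_map_product_projection[OF ij(2)]
        continuous_map_funpow[of k]] by (simp add: o_def)
  then show "closedin ?P S"
    unfolding S
    by (intro closedin_continuous_maps_eq[OF Hausdorff_space_mtopology]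
        continuous_map_product_projection ij)
  show "?P interior_of S = {}"
  proof (rule ccontr)
    assume "?P interior_of S \<noteq> {}"
    then obtain p where p: "p \<in> ?P interior_of S" by blast
    then obtain V where V: "\<And>l. l \<in> I \<Longrightarrow> openin mtopology (V l)" "p \<in> PiE I V"
      and sub: "PiE I V \<subseteq> ?P interior_of S"
      using openin_interior_of[of ?P S] unfolding openin_product_topology_alt by metis
    have "p i \<in> V i" using V(2) ij by auto
    then obtain e where e: "0 < e" "mball (p i) e \<subseteq> V i" "p i \<in> M"
      using V(1)[OF ij(1)] openin_mtopology by (metis (no_types) subsetD)
    then obtain y where y: "y \<in> V i" "y \<noteq> p i" using perfect[OF e(3,1)] by blast
    (* Moving only the i-th entry changes one side of the equation and keeps the other. *)
    have "p(i := y) \<in> PiE I V" using V(2) y ij by (auto simp: PiE_iff extensional_def)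
    then have "p(i := y) \<in> S" "p \<in> S"
      using sub p interior_of_subset[of ?P S] by blast+
    then show False using y ij S by auto
  qed
qed auto

theorem strachite_if_dense_backward_orbits:
  assumes dense: "\<And>a x e. a \<in> M \<Longrightarrow> x \<in> M \<Longrightarrow> 0 < e \<Longrightarrow> \<exists>y\<in>mball x e. \<exists>r. (f ^^ r) y = a"
    and perfect: "\<And>x e. x \<in> M \<Longrightarrow> 0 < e \<Longrightarrow> \<exists>y\<in>mball x e. y \<noteq> x"
  shows strachite
  unfolding strachite_def
proof (intro allI impI exI conjI ballI)
  fix N :: nat
  show "residual_in (product_topology (\<lambda>_. mtopology) {1..N})
    {p \<in> topspace (product_topology (\<lambda>_. mtopology) {1..N}).
       \<forall>i\<in>{1..N}. \<forall>j\<in>{1..N}. i \<noteq> j \<longrightarrow> (\<forall>k. (f ^^ k) (p j) \<noteq> p i)}"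
    by (rule residual_orbits_avoid_centers) (use perfect in auto)
next
  fix N :: nat and p :: "nat \<Rightarrow> 'a" and \<rho> :: "nat \<Rightarrow> nat \<Rightarrow> real"
  assume "1 \<le> N"
    and p: "p \<in> {p \<in> topspace (product_topology (\<lambda>_. mtopology) {1..N}).
       \<forall>i\<in>{1..N}. \<forall>j\<in>{1..N}. i \<noteq> j \<longrightarrow> (\<forall>k. (f ^^ k) (p j) \<noteq> p i)}"
    and \<rho>: "\<forall>i\<in>{1..N}. decseq (\<rho> i) \<and> (\<forall>n. 0 < \<rho> i n) \<and> \<rho> i \<longlonglongrightarrow> 0"
  have centers: "p i \<in> M" if "i \<in> {1..N}" for i
    using p that by (auto simp: PiE_iff)
  have orbits: "(f ^^ k) (p j) \<noteq> p i" if "i \<in> {1..N}" "j \<in> {1..N}" "i \<noteq> j" for i j k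
    using p that by blast
  show "completely_indecisive N p \<rho>"
    by (rule completely_indecisive_if_orbits_avoid_centers)
      (fact dense \<open>1 \<le> N\<close> centers orbits \<rho>[rule_format, THEN conjunct2, THEN conjunct1, rule_format]
        \<rho>[rule_format, THEN conjunct2, THEN conjunct2])+
qed

end

section \<open>The adding machine modulo the first digits\<close>

text \<open>The carry into position \<open>n\<close> when one is added, with the added one itself regarded as a carry
  into position \<open>0\<close>; this makes the recursion uniform in the position.\<close>

primrec succ_carry :: "(nat \<Rightarrow> nat) \<Rightarrow> (nat \<Rightarrow> nat) \<Rightarrow> nat \<Rightarrow> nat" where
  "succ_carry \<alpha> x 0 = 1"
| "succ_carry \<alpha> x (Suc n) = (x n + succ_carry \<alpha> x n) div \<alpha> n"

lemma adding_machine_succ_carry: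
  "adding_machine \<alpha> x n = (x n + succ_carry \<alpha> x n) mod \<alpha> n"
proof -
  have "(if n = 0 then 1 else 0) + carry \<alpha> x (\<lambda>n. if n = 0 then 1 else 0) n = succ_carry \<alpha> x n" for n
    by (induction n) (simp_all add: add.assoc split: if_splits)
  then show ?thesis by (simp add: adding_machine_def adding_plus_def add.assoc)
qed

text \<open>The number with mixed-radix digits \<open>x 0, \<dots>, x (L - 1)\<close>.\<close>

definition digits_value :: "(nat \<Rightarrow> nat) \<Rightarrow> nat \<Rightarrow> (nat \<Rightarrow> nat) \<Rightarrow> nat" where
  "digits_value \<alpha> L x = (\<Sum>n<L. x n * (\<Prod>m<n. \<alpha> m))"

text \<open>What the truncation to \<open>L\<close> digits loses is exactly the carry into position \<open>L\<close>. Recording it makes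
  the statement inductive; modulo the product of the first \<open>L\<close> radices it disappears.\<close>

lemma digits_value_adding_machine:
  "digits_value \<alpha> L (adding_machine \<alpha> x) + (\<Prod>m<L. \<alpha> m) * succ_carry \<alpha> x L
     = Suc (digits_value \<alpha> L x)"
proof (induction L)
  case (Suc L)
  let ?q = "\<Prod>m<L. \<alpha> m" and ?t = "x L + succ_carry \<alpha> x L"
  have "digits_value \<alpha> (Suc L) (adding_machine \<alpha> x) + (\<Prod>m<Suc L. \<alpha> m) * succ_carry \<alpha> x (Suc L)
      = digits_value \<alpha> L (adding_machine \<alpha> x)
        + (?q * (\<alpha> L * (?t div \<alpha> L)) + ?q * (?t mod \<alpha> L))"
    by (simp add: digits_value_def adding_machine_succ_carry mult_ac add_ac)
  also have "\<dots> = (digits_value \<alpha> L (adding_machine \<alpha> x) + ?q * succ_carry \<alpha> x L) + x L * ?q"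
    unfolding add_mult_distrib2[symmetric] mult_div_mod_eq by (simp add: algebra_simps)
  also have "\<dots> = Suc (digits_value \<alpha> (Suc L) x)"
    unfolding Suc.IH by (simp add: digits_value_def)
  finally show ?case .
qed (simp add: digits_value_def)

lemma digits_value_funpow_mod:
  "digits_value \<alpha> L ((adding_machine \<alpha> ^^ r) x) mod (\<Prod>m<L. \<alpha> m)
     = (digits_value \<alpha> L x + r) mod (\<Prod>m<L. \<alpha> m)"
proof (induction r)
  case (Suc r)
  have "digits_value \<alpha> L (adding_machine \<alpha> y) mod (\<Prod>m<L. \<alpha> m)
      = Suc (digits_value \<alpha> L y) mod (\<Prod>m<L. \<alpha> m)" for y
    using digits_value_adding_machine[of \<alpha> L y] by (metis mod_mult_self2)
  then show ?case using Suc by (metis add_Suc_right funpow.simps(2) comp_apply mod_Suc_eq)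
qed simp

context
  fixes \<alpha> :: "nat \<Rightarrow> nat"
  assumes \<alpha>: "\<forall>n. \<alpha> n \<ge> 2"
begin

lemma adding_space_iff: "x \<in> adding_space \<alpha> \<longleftrightarrow> (\<forall>n. x n < \<alpha> n)"
proof -
  have "x n \<le> \<alpha> n - 1 \<longleftrightarrow> x n < \<alpha> n" for n using \<alpha>[rule_format, of n] by auto
  then show ?thesis by (simp add: adding_space_def)
qed

lemma digits_value_less:
  assumes "x \<in> adding_space \<alpha>"
  shows "digits_value \<alpha> L x < (\<Prod>m<L. \<alpha> m)"
proof (induction L)
  case (Suc L)
  have "digits_value \<alpha> (Suc L) x < (\<Prod>m<L. \<alpha> m) + x L * (\<Prod>m<L. \<alpha> m)"
    using Suc by (simp add: digits_value_def)
  also have "\<dots> = Suc (x L) * (\<Prod>m<L. \<alpha> m)" by simp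
  also have "\<dots> \<le> \<alpha> L * (\<Prod>m<L. \<alpha> m)"
    by (rule mult_le_mono1) (use assms adding_space_iff Suc_le_eq in blast)
  finally show ?case by (simp add: mult.commute)
qed (simp add: digits_value_def)

lemma digits_eq_if_digits_value_eq:
  assumes "x \<in> adding_space \<alpha>" "y \<in> adding_space \<alpha>" "digits_value \<alpha> L x = digits_value \<alpha> L y"
  shows "\<forall>n<L. x n = y n"
  using assms(3)
proof (induction L)
  case (Suc L)
  let ?q = "\<Prod>m<L. \<alpha> m"
  have less: "digits_value \<alpha> L x < ?q" "digits_value \<alpha> L y < ?q"
    using assms digits_value_less by auto
  have eq: "digits_value \<alpha> L x + x L * ?q = digits_value \<alpha> L y + y L * ?q"
    using Suc.prems by (simp add: digits_value_def)
  have "digits_value \<alpha> L x = digits_value \<alpha> L y"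
    using arg_cong[OF eq, of "\<lambda>v. v mod ?q"] less by simp
  moreover from this have "x L * ?q = y L * ?q" using eq by simp
  then have "x L = y L" using less(1) by (metis mult_right_cancel not_less_zero)
  ultimately show ?case using Suc.IH less_Suc_eq by auto
qed simp

text \<open>A predecessor is found by borrowing: the zeros in front of the first non-zero digit become
  maximal digits, and that digit is decreased; if all digits are zero the borrow never stops.\<close>

lemma adding_machine_surj:
  assumes a: "a \<in> adding_space \<alpha>"
  shows "\<exists>y\<in>adding_space \<alpha>. adding_machine \<alpha> y = a"
proof -
  define b where "b n \<longleftrightarrow> (\<forall>k<n. a k = 0)" for n
  define y where "y n = (if b n then if a n = 0 then \<alpha> n - 1 else a n - 1 else a n)" for n
  have less: "a n < \<alpha> n" for n using a adding_space_iff by blast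
  have two: "2 \<le> \<alpha> n" for n using \<alpha> by blast
  have y_less: "y n < \<alpha> n" for n
    using less[of n] two[of n] by (auto simp: y_def)
  have b_Suc: "b (Suc n) \<longleftrightarrow> b n \<and> a n = 0" for n
    by (auto simp: b_def less_Suc_eq)
  have borrow: "succ_carry \<alpha> y n = of_bool (b n)" for n
  proof (induction n)
    case (Suc n)
    then show ?case using less[of n] two[of n] by (auto simp: b_Suc y_def)
  qed (simp add: b_def)
  have "adding_machine \<alpha> y n = a n" for n
    using less[of n] two[of n] by (auto simp: adding_machine_succ_carry borrow y_def)
  then show ?thesis using y_less adding_space_iff by blast
qed

lemma adding_machine_funpow_surj:
  assumes "a \<in> adding_space \<alpha>"
  shows "\<exists>y\<in>adding_space \<alpha>. (adding_machine \<alpha> ^^ r) y = a"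
  using assms
proof (induction r arbitrary: a)
  case (Suc r)
  then obtain z where "z \<in> adding_space \<alpha>" "adding_machine \<alpha> z = a"
    using adding_machine_surj by blast
  with Suc.IH[of z] show ?case by auto
qed auto

text \<open>For every order \<open>r\<close> there is a predecessor of \<open>a\<close>, and its first \<open>L\<close> digits depend only on the
  residue of \<open>r\<close>. A suitable residue produces the first \<open>L\<close> digits of \<open>x\<close>.\<close>

lemma backward_orbit_meets_cylinder:
  assumes a: "a \<in> adding_space \<alpha>" and x: "x \<in> adding_space \<alpha>"
  shows "\<exists>y\<in>adding_space \<alpha>. (\<forall>n<L. x n = y n) \<and> (\<exists>r. (adding_machine \<alpha> ^^ r) y = a)"
proof -
  let ?q = "\<Prod>m<L. \<alpha> m" and ?v = "digits_value \<alpha> L"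
  (* Up to a multiple of ?q this is ?v a - ?v x; the added ?q avoids truncated subtraction. *)
  define r where "r = ?v a + (?q - ?v x)"
  obtain y where y: "y \<in> adding_space \<alpha>" and ya: "(adding_machine \<alpha> ^^ r) y = a"
    using adding_machine_funpow_surj[OF a] by blast
  have less: "?v x < ?q" "?v y < ?q" using x y digits_value_less by auto
  have "(?v y + r) mod ?q = ?v a mod ?q"
    using digits_value_funpow_mod[of \<alpha> L r y] ya by simp
  then have "(?v y + r + ?v x) mod ?q = (?v a + ?v x) mod ?q" by (metis mod_add_left_eq)
  moreover have "?v y + r + ?v x = ?v a + ?v y + ?q" using less by (simp add: r_def)
  ultimately have "(?v a + ?v y) mod ?q = (?v a + ?v x) mod ?q" by simp
  then have "?v y mod ?q = ?v x mod ?q" by (simp add: nat_mod_eq_iff)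
  then have "?v x = ?v y" using less by simp
  then show ?thesis using digits_eq_if_digits_value_eq[OF x y] y ya by blast
qed

end

theorem theorem7:
  fixes \<alpha> :: "nat \<Rightarrow> nat"
  assumes "\<forall>n. \<alpha> n \<ge> 2"
  shows "dynamical_system.strachite (adding_space \<alpha>) adding_dist (adding_machine \<alpha>)"
proof -
  interpret dynamical_system "adding_space \<alpha>" adding_dist "adding_machine \<alpha>"
    by (rule dynamical_system_adding_machine[OF assms])
  have near: "\<exists>L. \<forall>y\<in>adding_space \<alpha>. (\<forall>n<L. x n = y n) \<longrightarrow> y \<in> mball x e"
    if "x \<in> adding_space \<alpha>" "0 < e" for x e
  proof -
    obtain L where "1 / 2 ^ L < e" using inverse_two_power_less \<open>0 < e\<close> by blast
    then have "y \<in> mball x e" if "y \<in> adding_space \<alpha>" "\<forall>n<L. x n = y n" for y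
      using that \<open>x \<in> adding_space \<alpha>\<close> adding_dist_less_iff[of x y L] by auto
    then show ?thesis by blast
  qed
  show ?thesis
  proof (rule strachite_if_dense_backward_orbits)
    fix a x and e :: real
    assume "a \<in> adding_space \<alpha>" "x \<in> adding_space \<alpha>" "0 < e"
    moreover from this obtain L
      where "\<forall>y\<in>adding_space \<alpha>. (\<forall>n<L. x n = y n) \<longrightarrow> y \<in> mball x e"
      using near by blast
    ultimately show "\<exists>y\<in>mball x e. \<exists>r. (adding_machine \<alpha> ^^ r) y = a"
      using backward_orbit_meets_cylinder[OF assms, of a x L] by blast
  next
    fix x and e :: real
    assume x: "x \<in> adding_space \<alpha>" and "0 < e"
    then obtain L where L: "\<forall>y\<in>adding_space \<alpha>. (\<forall>n<L. x n = y n) \<longrightarrow> y \<in> mball x e"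
      using near by blast
    (* The digit behind the prescribed ones has at least two possible values. *)
    let ?y = "x(L := if x L = 0 then 1 else 0)"
    have "1 < \<alpha> L" using assms[rule_format, of L] by simp
    then have "?y \<in> adding_space \<alpha>"
      using x by (auto simp: adding_space_iff[OF assms])
    then have "?y \<in> mball x e" using L by simp
    moreover have "?y \<noteq> x" by (simp add: fun_upd_idem_iff)
    ultimately show "\<exists>y\<in>mball x e. y \<noteq> x" by blast
  qed
qed

end
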